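(* Let $X$ be the full data with $p$ categorical predictors having $q_1,\ldots,q_p$ levels, and let $X_s$ be a subsample of $X$ of size $n$. If $f(X_s)=0$, where $$f(X_s)=\sqrt{\sum_{j=1}^{p}\sum_{u=1}^{q_j}q_j^2\left[\frac{1}{q_j}-\frac{n_j(u)}{n}\right]^2+\sum_{j=1}^{p}\sum_{\substack{k=1\\k\ne j}}^{p}\sum_{u=1}^{q_j}\sum_{v=1}^{q_k}q_jq_k\left[\frac{1}{q_jq_k}-\frac{n_{jk}(u,v)}{n}\right]^2},$$ then $X_s$ is $D$-optimal for the linear model with dummy variables $$y_i=\beta_0+\sum_{k=1}^{q_1-1}\beta_{1k}z_{i,1k}+\cdots+\sum_{k=1}^{q_p-1}\beta_{pk}z_{i,pk}+\varepsilon_i .$$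
   Context: The full data are an $N\times p$ matrix $X=(x_1,\ldots,x_N)^T$, whose row $x_i=(x_{i1},\ldots,x_{ip})^T$ contains the values of $p$ categorical predictors, with $x_{ij}\in\{1,\ldots,q_j\}$. Dummy coding: the $j$th predictor is coded by $q_j-1$ binary dummy variables. The $k$th dummy variable ($1\le k\le q_j-1$) of $x_{ij}$ is $z_{i,jk}=1$ if $x_{ij}=k$ and $z_{i,jk}=0$ otherwise (level $q_j$ is the baseline). The coded row for $x_i$ is $(1,z_{i,11},\ldots,z_{i,1(q_1-1)},\ldots,z_{i,p1},\ldots,z_{i,p(q_p-1)})$, including the leading $1$ for the intercept. $Z$ is the matrix with these $N$ rows. It is assumed that $Z^TZ$ is nonsingular. The errors $\varepsilon_i$ are independent with mean $0$ and variance $\sigma^2$. A subsample $X_s$ of size $n$ (with $n\geq 1$) is an $n\times p$ matrix formed by $n$ of the $N$ rows of $X$. $Z_s$ is the matrix formed by the corresponding $n$ rows of $Z$, and $M_s=Z_s^TZ_s$ is its information matrix. The least squares estimator of the coefficient vector based on $X_s$ has covariance matrix $\sigma^2M_s^{-1}$. $n_j(u)$ is the number of rows of $X_s$ in which the $j$th predictor takes level $u$. $n_{jk}(u,v)$ is the number of rows of $X_s$ in which the $j$th predictor takes level $u$ and the $k$th predictor takes level $v$. A subsample $X_s$ of size $n$ is $D$-optimal for the model if $M_s$ is nonsingular and $X_s$ minimizes $\det(M_s^{-1})$ among all subsamples of $X$ of size $n$ with nonsingular information matrix (equivalently, $X_s$ maximizes $\det(M_s)$ among all subsamples of size $n$).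 *)

theory Defs
  imports
    "HOL-Probability.Independent_Family"
    "Jordan_Normal_Form.Gauss_Jordan_Elimination"
    "Jordan_Normal_Form.Determinant"
begin

unbundle no vec_syntax
hide_const (open) Determinants.det Finite_Cartesian_Product.vec

text \<open>
  Data are matrices over \<^typ>\<open>nat\<close>: rows are observations, columns are predictors. Rows and
  columns are indexed from 0, whereas levels are the numbers 1 to \<open>q j\<close>.
\<close>

definition categorical_data :: "nat \<Rightarrow> nat \<Rightarrow> (nat \<Rightarrow> nat) \<Rightarrow> nat mat \<Rightarrow> bool" where
  "categorical_data N p q X \<longleftrightarrow>
     X \<in> carrier_mat N p \<and> (\<forall>i<N. \<forall>j<p. X $$ (i, j) \<in> {1..q j})"

definition dummy :: "nat mat \<Rightarrow> nat \<Rightarrow> nat \<Rightarrow> nat \<Rightarrow> real" where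
  "dummy X i j k = (if X $$ (i, j) = k then 1 else 0)"

text \<open>Level \<open>q j\<close> is the baseline, so the dummy variables of predictor \<open>j\<close> belong to
  the levels in \<open>[1..<q j]\<close>.\<close>

definition coded_row :: "(nat \<Rightarrow> nat) \<Rightarrow> nat mat \<Rightarrow> nat \<Rightarrow> real list" where
  "coded_row q X i =
     1 # concat (map (\<lambda>j. map (\<lambda>k. dummy X i j k) [1..<q j]) [0..<dim_col X])"

definition num_coeffs :: "(nat \<Rightarrow> nat) \<Rightarrow> nat \<Rightarrow> nat" where
  "num_coeffs q p = 1 + (\<Sum>j<p. q j - 1)"

lemma length_coded_row: "length (coded_row q X i) = num_coeffs q (dim_col X)"
  by (simp add: coded_row_def num_coeffs_def length_concat comp_def
      interv_sum_list_conv_sum_set_nat atLeast0LessThan)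

definition model_mat :: "(nat \<Rightarrow> nat) \<Rightarrow> nat mat \<Rightarrow> real mat" where
  "model_mat q X =
     mat (dim_row X) (num_coeffs q (dim_col X)) (\<lambda>(i, c). coded_row q X i ! c)"

definition information_mat :: "(nat \<Rightarrow> nat) \<Rightarrow> nat mat \<Rightarrow> real mat" where
  "information_mat q X = transpose_mat (model_mat q X) * model_mat q X"

definition linear_model ::
  "'w measure \<Rightarrow> (nat \<Rightarrow> nat) \<Rightarrow> nat mat \<Rightarrow> real \<Rightarrow> (nat \<Rightarrow> nat \<Rightarrow> real) \<Rightarrow> real \<Rightarrow>
    (nat \<Rightarrow> 'w \<Rightarrow> real) \<Rightarrow> (nat \<Rightarrow> 'w \<Rightarrow> real) \<Rightarrow> bool"
where
  "linear_model W q X \<beta>0 \<beta> \<sigma> \<epsilon> y \<longleftrightarrow>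
     prob_space W \<and>
     prob_space.indep_vars W (\<lambda>_. borel) \<epsilon> {..<dim_row X} \<and>
     (\<forall>i<dim_row X.
        integrable W (\<epsilon> i) \<and> integrable W (\<lambda>\<omega>. (\<epsilon> i \<omega>)\<^sup>2) \<and>
        prob_space.expectation W (\<epsilon> i) = 0 \<and>
        prob_space.variance W (\<epsilon> i) = \<sigma>\<^sup>2 \<and>
        (\<forall>\<omega>\<in>space W.
           y i \<omega> = \<beta>0 + (\<Sum>j<dim_col X. \<Sum>k\<in>{1..<q j}. \<beta> j k * dummy X i j k) + \<epsilon> i \<omega>))"

definition select_rows :: "'a mat \<Rightarrow> nat \<Rightarrow> (nat \<Rightarrow> nat) \<Rightarrow> 'a mat" where
  "select_rows A n s = mat n (dim_col A) (\<lambda>(i, j). A $$ (s i, j))"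

text \<open>Rows are drawn without replacement: injectivity concerns row indices, so rows of \<open>X\<close>
  with equal entries may all be drawn.\<close>

definition subsample :: "nat mat \<Rightarrow> nat \<Rightarrow> nat mat \<Rightarrow> bool" where
  "subsample X n Xs \<longleftrightarrow>
     (\<exists>s. inj_on s {..<n} \<and> s ` {..<n} \<subseteq> {..<dim_row X} \<and> Xs = select_rows X n s)"

text \<open>Coding is done row by row, so coding a subsample gives the corresponding rows of the
  coded full data.\<close>

lemma model_mat_select_rows:
  assumes "s ` {..<n} \<subseteq> {..<dim_row X}"
  shows "model_mat q (select_rows X n s) = select_rows (model_mat q X) n s"
proof -
  have "coded_row q (select_rows X n s) i = coded_row q X (s i)" if "i < n" for i
  proof -
    have "dummy (select_rows X n s) i j k = dummy X (s i) j k" if "j < dim_col X" for j k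
      using \<open>i < n\<close> that by (simp add: dummy_def select_rows_def)
    then show ?thesis
      by (auto simp: coded_row_def select_rows_def intro!: arg_cong[where f = concat])
  qed
  then show ?thesis
    using assms by (intro eq_matI) (auto simp: model_mat_def select_rows_def)
qed

text \<open>For an invertible matrix \<^const>\<open>mat_inverse\<close> returns its inverse, wrapped in
  \<^const>\<open>Some\<close>.\<close>

definition D_optimal :: "(nat \<Rightarrow> nat) \<Rightarrow> nat mat \<Rightarrow> nat \<Rightarrow> nat mat \<Rightarrow> bool" where
  "D_optimal q X n Xs \<longleftrightarrow>
     subsample X n Xs \<and> invertible_mat (information_mat q Xs) \<and>
     (\<forall>Xt. subsample X n Xt \<and> invertible_mat (information_mat q Xt) \<longrightarrow>
        det (the (mat_inverse (information_mat q Xs)))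
          \<le> det (the (mat_inverse (information_mat q Xt))))"

definition level_count :: "nat mat \<Rightarrow> nat \<Rightarrow> nat \<Rightarrow> nat" where
  "level_count Xs j u = card {i. i < dim_row Xs \<and> Xs $$ (i, j) = u}"

definition pair_count :: "nat mat \<Rightarrow> nat \<Rightarrow> nat \<Rightarrow> nat \<Rightarrow> nat \<Rightarrow> nat" where
  "pair_count Xs j k u v =
     card {i. i < dim_row Xs \<and> Xs $$ (i, j) = u \<and> Xs $$ (i, k) = v}"

definition balance_criterion :: "(nat \<Rightarrow> nat) \<Rightarrow> nat mat \<Rightarrow> real" where
  "balance_criterion q Xs =
     (let p = dim_col Xs; n = dim_row Xs in
      sqrt ((\<Sum>j<p. \<Sum>u=1..q j.
               (real (q j))\<^sup>2 * (1 / real (q j) - real (level_count Xs j u) / real n)\<^sup>2)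
          + (\<Sum>j<p. \<Sum>k\<in>{..<p} - {j}. \<Sum>u=1..q j. \<Sum>v=1..q k.
               real (q j) * real (q k) *
                 (1 / (real (q j) * real (q k)) - real (pair_count Xs j k u v) / real n)\<^sup>2)))"

end

theory Submission
  imports Defs
begin

text \<open>
  Replacing the dummy variables of every predictor by orthonormal (Helmert) contrasts multiplies
  the model matrix by a matrix \<open>T\<close> that depends only on the numbers of levels. In the new coding
  every row has squared norm \<open>m\<close>, the number of coefficients, so the Gram matrix of any \<open>n\<close>
  rows has trace \<open>n m\<close>; by Hadamard's inequality and \<open>1 + x \<le> exp x\<close> its determinant is at most
  \<open>n ^ m\<close>. If the criterion vanishes, all one- and two-dimensional counts are balanced, and the
  Gram matrix is \<open>n\<close> times the identity, which attains the bound. The factor \<open>(det T)\<^sup>2\<close>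
  relating the determinants in the two codings is the same for all subsamples.
\<close>

section \<open>Determinants\<close>

lemma det_mat_inverse:
  fixes A :: "'a :: field mat"
  assumes A: "A \<in> carrier_mat m m" and "det A \<noteq> 0"
  shows "det (the (mat_inverse A)) = 1 / det A"
proof (cases "mat_inverse A")
  case None
  then show ?thesis
    using mat_inverse(1)[OF A, of "()"] det_non_zero_imp_unit[OF A \<open>det A \<noteq> 0\<close>, of "()"]
    by blast
next
  case (Some B)
  then have B: "A * B = 1\<^sub>m m" "B \<in> carrier_mat m m"
    using mat_inverse(2)[OF A] by auto
  then have "det A * det B = 1"
    using det_mult[OF A B(2)] by simp
  then show ?thesis
    using Some \<open>det A \<noteq> 0\<close> by (simp add: field_simps)
qed

lemma invertible_mat_iff_det:
  fixes A :: "'a :: field mat"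
  assumes A: "A \<in> carrier_mat m m"
  shows "invertible_mat A \<longleftrightarrow> det A \<noteq> 0"
proof
  assume "invertible_mat A"
  then obtain B where B: "A * B = 1\<^sub>m m" "B * A = 1\<^sub>m (dim_row B)"
    using A by (auto simp: invertible_mat_def inverts_mat_def)
  \<comment> \<open>\<open>inverts_mat\<close> does not fix the shape of \<open>B\<close>; comparing
    column counts in the two product equations does.\<close>
  have "dim_col B = m" "dim_row B = m"
    using A arg_cong[OF B(1), of dim_col] arg_cong[OF B(2), of dim_col] by auto
  then have "det A * det B = 1"
    using B(1) det_mult[OF A, of B] by auto
  then show "det A \<noteq> 0" by auto
next
  assume "det A \<noteq> 0"
  then obtain B where "B \<in> carrier_mat m m" "A * B = 1\<^sub>m m" "B * A = 1\<^sub>m m"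
    using det_non_zero_imp_unit[OF A, of "()"] by (auto simp: Units_def ring_mat_def)
  then show "invertible_mat A"
    using A by (auto simp: invertible_mat_def inverts_mat_def)
qed

section \<open>Gram determinants and Hadamard's inequality\<close>

lemma gram_index:
  assumes "Z \<in> carrier_mat r m" "c < m" "d < m"
  shows "(transpose_mat Z * Z) $$ (c, d) = (\<Sum>i<r. Z $$ (i, c) * Z $$ (i, d))"
  using assms by (simp add: scalar_prod_def atLeast0LessThan)

text \<open>Serves twice: with a unit triangular \<open>T\<close> for one elimination step in
  Hadamard's inequality, and with the recoding matrix for the change from dummy to contrast
  coding.\<close>

lemma det_gram_mult:
  fixes Z :: "real mat"
  assumes Z: "Z \<in> carrier_mat r m" and T: "T \<in> carrier_mat m m"
  shows "det (transpose_mat (Z * T) * (Z * T)) = (det T)\<^sup>2 * det (transpose_mat Z * Z)"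
proof -
  have "transpose_mat (Z * T) * (Z * T) = (transpose_mat T * transpose_mat Z) * (Z * T)"
    by (simp add: transpose_mult[OF Z T])
  also have "\<dots> = transpose_mat T * (transpose_mat Z * (Z * T))"
    by (rule assoc_mult_mat) (use Z T in auto)
  also have "transpose_mat Z * (Z * T) = (transpose_mat Z * Z) * T"
    by (rule assoc_mult_mat[symmetric]) (use Z T in auto)
  finally have eq: "transpose_mat (Z * T) * (Z * T) = transpose_mat T * ((transpose_mat Z * Z) * T)" .
  have ZZ: "transpose_mat Z * Z \<in> carrier_mat m m"
    using Z by simp
  show ?thesis
    unfolding eq using ZZ T
    by (simp add: det_mult[of _ m] det_transpose[OF T] power2_eq_square)
qed

text \<open>Orthogonality clears the first column of the Gram matrix below the diagonal, so the
  Laplace expansion has a single term. Its minor is the Gram matrix of the remaining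
  columns.\<close>

lemma det_orthogonal_first_column:
  fixes W :: "real mat"
  assumes W: "W \<in> carrier_mat r (Suc m)"
    and orth: "\<And>c. c < m \<Longrightarrow> (\<Sum>i<r. W $$ (i, Suc c) * W $$ (i, 0)) = 0"
  defines "V \<equiv> mat r m (\<lambda>(i, c). W $$ (i, Suc c))"
  shows "det (transpose_mat W * W) = (\<Sum>i<r. (W $$ (i, 0))\<^sup>2) * det (transpose_mat V * V)"
proof -
  let ?G = "transpose_mat W * W"
  have G: "?G \<in> carrier_mat (Suc m) (Suc m)"
    using W by simp
  have V: "V \<in> carrier_mat r m"
    by (simp add: V_def)
  have "det ?G = (\<Sum>c<Suc m. ?G $$ (c, 0) * cofactor ?G c 0)"
    by (rule laplace_expansion_column[OF G]) simp
  also have "\<dots> = ?G $$ (0, 0) * cofactor ?G 0 0"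
    unfolding sum.lessThan_Suc_shift
    using orth by (simp add: gram_index[OF W] del: index_mult_mat)
  also have "mat_delete ?G 0 0 = transpose_mat V * V"
  proof (rule eq_matI)
    fix c d assume "c < dim_row (transpose_mat V * V)" "d < dim_col (transpose_mat V * V)"
    then have "c < m" "d < m" by (auto simp: V_def)
    then show "mat_delete ?G 0 0 $$ (c, d) = (transpose_mat V * V) $$ (c, d)"
      using W gram_index[OF V] gram_index[OF W]
      by (simp add: mat_delete_def V_def del: index_mult_mat(1))
  qed (use W in \<open>auto simp: V_def mat_delete_def\<close>)
  then have "cofactor ?G 0 0 = det (transpose_mat V * V)"
    by (simp add: cofactor_def)
  finally show ?thesis
    by (simp add: gram_index[OF W] power2_eq_square del: index_mult_mat)
qed

text \<open>Hadamard's inequality by induction on the number of columns. One Gram-Schmidt step makes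
  the later columns orthogonal to the first: it keeps the determinant and does not lengthen any
  column. Nonnegativity comes out of the same recursion.\<close>

lemma gram_det_bounds:
  fixes Z :: "real mat"
  assumes "Z \<in> carrier_mat r m"
  shows "0 \<le> det (transpose_mat Z * Z)
    \<and> det (transpose_mat Z * Z) \<le> (\<Prod>c<m. \<Sum>i<r. (Z $$ (i, c))\<^sup>2)"
  using assms
proof (induction m arbitrary: Z)
  case 0
  then have "transpose_mat Z * Z \<in> carrier_mat 0 0" by simp
  then show ?case by simp
next
  case (Suc m)
  note Z = Suc.prems
  define G where "G d = (\<Sum>i<r. Z $$ (i, 0) * Z $$ (i, d))" for d
  define a where "a = (\<Sum>i<r. (Z $$ (i, 0))\<^sup>2)"
  \<comment> \<open>Multiplying by \<open>E\<close> on the right subtracts from each later column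
    its projection onto column 0.\<close>
  define E where "E = mat (Suc m) (Suc m)
    (\<lambda>(c, d). if c = d then 1 else if c = 0 then - G d / a else 0)"
  define W where "W = Z * E"
  define V where "V = mat r m (\<lambda>(i, c). W $$ (i, Suc c))"
  have a0: "a \<ge> 0"
    unfolding a_def by (rule sum_nonneg) simp
  \<comment> \<open>If \<open>a = 0\<close>, column 0 is zero. Division by zero then makes
    \<open>E\<close> the identity, and orthogonality still holds because every \<open>G d\<close>
    vanishes.\<close>
  have G0: "G d = 0" if "a = 0" for d
  proof -
    have "\<forall>i\<in>{..<r}. (Z $$ (i, 0))\<^sup>2 = 0"
      using that unfolding a_def by (subst (asm) sum_nonneg_eq_0_iff) auto
    then show ?thesis by (simp add: G_def)
  qed
  have E: "E \<in> carrier_mat (Suc m) (Suc m)"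
    by (simp add: E_def)
  have W: "W \<in> carrier_mat r (Suc m)"
    using Z E by (simp add: W_def)
  have V: "V \<in> carrier_mat r m"
    by (simp add: V_def)
  have "upper_triangular E" and diagE: "diag_mat E = replicate (Suc m) 1"
    by (auto simp: E_def diag_mat_def intro!: nth_equalityI simp del: upt_Suc replicate_Suc)
  then have detE: "det E = 1"
    using det_upper_triangular[OF _ E] by simp
  have Wi: "W $$ (i, d) = (\<Sum>c<Suc m. Z $$ (i, c) * E $$ (c, d))" if "i < r" "d < Suc m" for i d
    using that Z E by (simp add: W_def scalar_prod_def atLeast0LessThan)
  have W0: "W $$ (i, 0) = Z $$ (i, 0)" if "i < r" for i
    unfolding Wi[OF that zero_less_Suc] sum.lessThan_Suc_shift by (simp add: E_def)
  have WS: "W $$ (i, Suc d) = Z $$ (i, Suc d) - Z $$ (i, 0) * G (Suc d) / a"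
    if "i < r" "d < m" for i d
  proof -
    have "W $$ (i, Suc d) = (\<Sum>c<Suc m. Z $$ (i, c) * E $$ (c, Suc d))"
      using Wi that by simp
    also have "\<dots> = - Z $$ (i, 0) * G (Suc d) / a
        + (\<Sum>c<m. if c = d then Z $$ (i, Suc c) else 0)"
      unfolding sum.lessThan_Suc_shift using that
      by (intro arg_cong2[where f = "(+)"] sum.cong) (auto simp: E_def)
    finally show ?thesis using that by simp
  qed
  have orth: "(\<Sum>i<r. W $$ (i, Suc c) * W $$ (i, 0)) = 0" if "c < m" for c
  proof -
    have "(\<Sum>i<r. W $$ (i, Suc c) * W $$ (i, 0))
        = (\<Sum>i<r. Z $$ (i, 0) * Z $$ (i, Suc c) - (Z $$ (i, 0))\<^sup>2 * (G (Suc c) / a))"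
      using that by (intro sum.cong) (auto simp: WS W0 power2_eq_square algebra_simps)
    also have "\<dots> = G (Suc c) - a * (G (Suc c) / a)"
      unfolding sum_subtractf a_def[symmetric] sum_distrib_right[symmetric]
      by (simp add: G_def)
    finally show ?thesis using G0 by (cases "a = 0") auto
  qed
  have norm_le: "(\<Sum>i<r. (V $$ (i, c))\<^sup>2) \<le> (\<Sum>i<r. (Z $$ (i, Suc c))\<^sup>2)" if "c < m" for c
  proof -
    have "(\<Sum>i<r. (V $$ (i, c))\<^sup>2)
        = (\<Sum>i<r. (Z $$ (i, Suc c))\<^sup>2 - 2 * (G (Suc c) / a) * (Z $$ (i, 0) * Z $$ (i, Suc c))
            + (G (Suc c) / a)\<^sup>2 * (Z $$ (i, 0))\<^sup>2)"
      using that by (intro sum.cong) (auto simp: V_def WS power2_eq_square algebra_simps)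
    also have "\<dots> = (\<Sum>i<r. (Z $$ (i, Suc c))\<^sup>2) - 2 * (G (Suc c) / a) * G (Suc c)
        + (G (Suc c) / a)\<^sup>2 * a"
      by (simp add: sum_subtractf sum.distrib G_def a_def sum_distrib_left)
    \<comment> \<open>Pythagoras: the squared norm drops by that of the projection, a quotient that
      is 0 by convention when \<open>a = 0\<close>.\<close>
    also have "\<dots> = (\<Sum>i<r. (Z $$ (i, Suc c))\<^sup>2) - (G (Suc c))\<^sup>2 / a"
      by (cases "a = 0") (auto simp: power2_eq_square field_simps)
    also have "\<dots> \<le> (\<Sum>i<r. (Z $$ (i, Suc c))\<^sup>2)"
      using a0 by simp
    finally show ?thesis .
  qed
  have "det (transpose_mat Z * Z) = det (transpose_mat W * W)"
    using det_gram_mult[OF Z E] detE by (simp add: W_def)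
  also have "\<dots> = (\<Sum>i<r. (W $$ (i, 0))\<^sup>2) * det (transpose_mat V * V)"
    unfolding V_def using orth by (rule det_orthogonal_first_column[OF W])
  also have "(\<Sum>i<r. (W $$ (i, 0))\<^sup>2) = a"
    unfolding a_def by (intro sum.cong) (auto simp: W0)
  finally have det_eq: "det (transpose_mat Z * Z) = a * det (transpose_mat V * V)" .
  have "(\<Prod>c<m. \<Sum>i<r. (V $$ (i, c))\<^sup>2) \<le> (\<Prod>c<m. \<Sum>i<r. (Z $$ (i, Suc c))\<^sup>2)"
    using norm_le by (intro prod_mono) (auto intro: sum_nonneg)
  then have "a * det (transpose_mat V * V) \<le> a * (\<Prod>c<m. \<Sum>i<r. (Z $$ (i, Suc c))\<^sup>2)"
    using Suc.IH[OF V] a0 by (intro mult_left_mono) auto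
  then show ?case
    using Suc.IH[OF V] a0 unfolding det_eq prod.lessThan_Suc_shift by (simp add: a_def)
qed

text \<open>The inequality of arithmetic and geometric means. Each \<open>x c / n\<close> is at most
  \<open>exp (x c / n - 1)\<close>, and these exponents add up to 0 because \<open>n\<close> is the
  mean.\<close>

lemma prod_le_power_of_sum:
  fixes x :: "'a \<Rightarrow> real" and n :: real
  assumes "finite A" "\<And>c. c \<in> A \<Longrightarrow> 0 \<le> x c" "n > 0" "(\<Sum>c\<in>A. x c) = n * card A"
  shows "(\<Prod>c\<in>A. x c) \<le> n ^ card A"
proof -
  have "(\<Prod>c\<in>A. x c / n) \<le> (\<Prod>c\<in>A. exp (x c / n - 1))"
  proof (rule prod_mono)
    fix c assume "c \<in> A"
    then show "0 \<le> x c / n \<and> x c / n \<le> exp (x c / n - 1)"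
      using assms exp_ge_add_one_self[of "x c / n - 1"] by simp
  qed
  also have "\<dots> = exp (\<Sum>c\<in>A. x c / n - 1)"
    using assms by (simp add: exp_sum)
  also have "(\<Sum>c\<in>A. x c / n - 1) = 0"
    using assms by (simp add: sum_subtractf flip: sum_divide_distrib)
  finally have "(\<Prod>c\<in>A. x c) / n ^ card A \<le> 1"
    using assms by (simp add: prod_dividef)
  then show ?thesis
    using assms by (simp add: field_simps)
qed

text \<open>Swapping sums turns the row norms into the total of the squared column norms. Their mean
  is therefore \<open>r\<close>, and the two preceding inequalities combine.\<close>

lemma det_gram_le_power:
  fixes Z :: "real mat"
  assumes Z: "Z \<in> carrier_mat r m" and "r > 0"
    and rows: "\<And>i. i < r \<Longrightarrow> (\<Sum>c<m. (Z $$ (i, c))\<^sup>2) = real m"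
  shows "det (transpose_mat Z * Z) \<le> real r ^ m"
proof -
  have "(\<Sum>c<m. \<Sum>i<r. (Z $$ (i, c))\<^sup>2) = (\<Sum>i<r. real m)"
    using rows by (subst sum.swap) (intro sum.cong, auto)
  then have "(\<Prod>c<m. \<Sum>i<r. (Z $$ (i, c))\<^sup>2) \<le> real r ^ card {..<m}"
    using \<open>r > 0\<close> by (intro prod_le_power_of_sum) (auto intro: sum_nonneg)
  then show ?thesis
    using gram_det_bounds[OF Z] by simp
qed

section \<open>Helmert contrasts\<close>

text \<open>For \<open>1 \<le> k < q\<close>, the \<open>k\<close>th contrast compares level
  \<open>k + 1\<close> with the levels up to \<open>k\<close>. The square root scales its mean
  square over the \<open>q\<close> levels to 1.\<close>

definition helmert :: "nat \<Rightarrow> nat \<Rightarrow> nat \<Rightarrow> real" where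
  "helmert q k u = sqrt (real q / (real k * (real k + 1))) *
     (if u \<le> k then 1 else if u = Suc k then - real k else 0)"

text \<open>Inner product with an arbitrary \<open>f\<close>; the zero sum, orthogonality and the
  norm of the contrasts are instances.\<close>

lemma sum_helmert_mult:
  assumes "k < q"
  shows "(\<Sum>u=1..q. helmert q k u * f u)
    = sqrt (real q / (real k * (real k + 1))) * ((\<Sum>u=1..k. f u) - real k * f (Suc k))"
proof -
  let ?s = "sqrt (real q / (real k * (real k + 1)))"
  have "{1..q} = {1..k} \<union> {Suc k..q}"
    using assms by auto
  then have "(\<Sum>u=1..q. helmert q k u * f u)
      = (\<Sum>u=1..k. helmert q k u * f u) + (\<Sum>u=Suc k..q. helmert q k u * f u)"
    by (simp add: sum.union_disjoint)
  also have "(\<Sum>u=1..k. helmert q k u * f u) = ?s * (\<Sum>u=1..k. f u)"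
    unfolding sum_distrib_left by (intro sum.cong) (auto simp: helmert_def)
  also have "(\<Sum>u=Suc k..q. helmert q k u * f u)
      = (\<Sum>u=Suc k..q. if u = Suc k then - (?s * real k * f (Suc k)) else 0)"
    by (intro sum.cong) (auto simp: helmert_def)
  also have "\<dots> = - (?s * real k * f (Suc k))"
    using assms by simp
  finally show ?thesis
    by (simp add: algebra_simps)
qed

lemma sum_helmert:
  assumes "k < q"
  shows "(\<Sum>u=1..q. helmert q k u) = 0"
  using sum_helmert_mult[OF assms, of "\<lambda>_. 1"] by simp

text \<open>The later contrast is constant on the levels \<open>1..Suc k\<close>, which carry the
  earlier one, and the earlier one sums to zero.\<close>

lemma sum_helmert_orthogonal:
  assumes "1 \<le> k" "k < l" "l < q"
  shows "(\<Sum>u=1..q. helmert q k u * helmert q l u) = 0"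
proof -
  have "(\<Sum>u=1..k. helmert q l u) = (\<Sum>u=1..k. helmert q l (Suc k))"
    using assms by (intro sum.cong) (auto simp: helmert_def)
  then show ?thesis
    using assms by (subst sum_helmert_mult) auto
qed

lemma sum_helmert_square:
  assumes "1 \<le> k" "k < q"
  shows "(\<Sum>u=1..q. helmert q k u * helmert q k u) = real q"
proof -
  let ?s = "sqrt (real q / (real k * (real k + 1)))"
  have "(\<Sum>u=1..k. helmert q k u) = real k * ?s"
    by (simp add: helmert_def)
  then have "(\<Sum>u=1..q. helmert q k u * helmert q k u) = ?s\<^sup>2 * (real k * (real k + 1))"
    using assms by (subst sum_helmert_mult) (auto simp: helmert_def power2_eq_square algebra_simps add_divide_distrib)
  also have "\<dots> = real q"
    using assms by simp
  finally show ?thesis .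
qed

lemma sum_helmert_mult_helmert:
  assumes "k \<in> {1..<q}" "l \<in> {1..<q}"
  shows "(\<Sum>u=1..q. helmert q k u * helmert q l u) = (if k = l then real q else 0)"
  using assms sum_helmert_orthogonal[of k l q] sum_helmert_orthogonal[of l k q]
    sum_helmert_square[of k q]
  by (cases k l rule: linorder_cases) (auto simp: mult.commute)

text \<open>Up to the factor \<open>q\<close>, the contrast \<open>k = u - 1\<close> contributes
  \<open>1 - 1/u\<close> (nothing if \<open>u = 1\<close>), and each \<open>k \<ge> u\<close>
  contributes \<open>1/k - 1/(k + 1)\<close>, so the sum telescopes.\<close>

lemma sum_helmert_over_contrasts:
  assumes "u \<in> {1..q}"
  shows "(\<Sum>k\<in>{1..<q}. (helmert q k u)\<^sup>2) = real q - 1"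
proof -
  \<comment> \<open>The squared contrast without its factor \<open>q\<close>: no longer dependent on
    \<open>q\<close>, it allows induction on the upper limit of the sum.\<close>
  define g where "g k = (if u \<le> k then 1 else if u = Suc k then - real k else 0)\<^sup>2
    / (real k * (real k + 1))" for k
  have "(\<Sum>k\<in>{1..<Q}. g k) = 1 - 1 / real Q" if "u \<le> Q" for Q
    using that
  proof (induction Q rule: dec_induct)
    case base
    show ?case
    proof (cases "u = 1")
      case False
      then have "u - 1 \<in> {1..<u}"
        using assms by auto
      \<comment> \<open>Contrasts with \<open>k < u - 1\<close> vanish at level
        \<open>u\<close>.\<close>
      then have "(\<Sum>k\<in>{1..<u}. g k) = g (u - 1) + (\<Sum>k\<in>{1..<u} - {u - 1}. g k)"
        by (intro sum.remove) auto
      also have "(\<Sum>k\<in>{1..<u} - {u - 1}. g k) = 0"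
        by (intro sum.neutral) (auto simp: g_def)
      also have "g (u - 1) + 0 = 1 - 1 / real u"
        using False assms by (auto simp: g_def power2_eq_square field_simps)
      finally show ?thesis .
    qed simp
  next
    case (step Q)
    have "{1..<Suc Q} = insert Q {1..<Q}"
      using assms step.hyps by auto
    then have "(\<Sum>k\<in>{1..<Suc Q}. g k) = g Q + (1 - 1 / real Q)"
      using step.IH by simp
    also have "\<dots> = 1 - 1 / real (Suc Q)"
    proof -
      have "real Q > 0" "real Q + real Q * real Q > 0"
        using assms step.hyps by (auto intro: add_pos_pos)
      then show ?thesis
        using step.hyps by (auto simp: g_def field_simps)
    qed
    finally show ?case .
  qed
  from this[of q] have "(\<Sum>k\<in>{1..<q}. real q * g k) = real q - 1"
    using assms by (simp add: field_simps flip: sum_distrib_left)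
  moreover have "(helmert q k u)\<^sup>2 = real q * g k" for k
    by (simp add: helmert_def g_def power_mult_distrib)
  ultimately show ?thesis by simp
qed

section \<open>Contrast coding\<close>

text \<open>Column labels of the model matrix: \<^const>\<open>None\<close> is the intercept, and \<open>Some (j, k)\<close> the
  \<open>k\<close>th dummy variable of predictor \<open>j\<close>.\<close>

definition labels :: "(nat \<Rightarrow> nat) \<Rightarrow> nat \<Rightarrow> (nat \<times> nat) option list" where
  "labels q p = None # map Some (concat (map (\<lambda>j. map (Pair j) [1..<q j]) [0..<p]))"

lemma length_labels: "length (labels q p) = num_coeffs q p"
  by (simp add: labels_def num_coeffs_def length_concat comp_def
      interv_sum_list_conv_sum_set_nat atLeast0LessThan)

lemma set_labels: "set (labels q p) = insert None (Some ` (SIGMA j:{..<p}. {1..<q j}))"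
  by (force simp: labels_def)

lemma distinct_labels: "distinct (labels q p)"
proof -
  have "distinct (concat (map (\<lambda>j. map (Pair j) [1..<q j]) [0..<p]))"
    by (induction p) (auto simp: distinct_map inj_on_def)
  then show ?thesis
    by (auto simp: labels_def distinct_map)
qed

lemma sum_labels:
  fixes F :: "(nat \<times> nat) option \<Rightarrow> real"
  shows "(\<Sum>c<num_coeffs q p. F (labels q p ! c))
    = F None + (\<Sum>j<p. \<Sum>k\<in>{1..<q j}. F (Some (j, k)))"
proof -
  have "bij_betw ((!) (labels q p)) {..<num_coeffs q p} (set (labels q p))"
    by (intro bij_betw_nth) (auto simp: distinct_labels length_labels)
  then have "(\<Sum>c<num_coeffs q p. F (labels q p ! c)) = (\<Sum>b\<in>set (labels q p). F b)"
    by (rule sum.reindex_bij_betw)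
  also have "\<dots> = F None + (\<Sum>b\<in>(SIGMA j:{..<p}. {1..<q j}). F (Some b))"
    unfolding set_labels by (subst sum.insert) (auto simp: sum.reindex)
  also have "(\<Sum>b\<in>(SIGMA j:{..<p}. {1..<q j}). F (Some b))
      = (\<Sum>j<p. \<Sum>k\<in>{1..<q j}. F (Some (j, k)))"
    by (subst sum.Sigma) auto
  finally show ?thesis .
qed

lemma nth_labels_cases:
  assumes "c < num_coeffs q p"
  obtains "labels q p ! c = None"
    | j k where "labels q p ! c = Some (j, k)" "j < p" "k \<in> {1..<q j}"
  using nth_mem[of c "labels q p"] assms unfolding length_labels set_labels by auto

fun dummy_at :: "nat mat \<Rightarrow> nat \<Rightarrow> (nat \<times> nat) option \<Rightarrow> real" where
  "dummy_at X i None = 1"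
| "dummy_at X i (Some (j, k)) = dummy X i j k"

fun contrast_at :: "(nat \<Rightarrow> nat) \<Rightarrow> nat mat \<Rightarrow> nat \<Rightarrow> (nat \<times> nat) option \<Rightarrow> real" where
  "contrast_at q X i None = 1"
| "contrast_at q X i (Some (j, k)) = helmert (q j) k (X $$ (i, j))"

text \<open>Coefficients of the expansion
  \<open>h u = h q + (\<Sum>l<q. (h l - h q) * (if u = l then 1 else 0))\<close> of a function \<open>h\<close> of the
  levels in the dummy variables.\<close>

fun recode :: "(nat \<Rightarrow> nat) \<Rightarrow> (nat \<times> nat) option \<Rightarrow> (nat \<times> nat) option \<Rightarrow> real" where
  "recode q None None = 1"
| "recode q (Some _) None = 0"
| "recode q None (Some (j, k)) = helmert (q j) k (q j)"
| "recode q (Some (i, l)) (Some (j, k)) =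
     (if i = j then helmert (q j) k l - helmert (q j) k (q j) else 0)"

text \<open>Column \<open>c\<close> holds the coefficients of one contrast in the dummy coding, so
  this matrix acts on the model matrix from the right.\<close>

definition recode_mat :: "(nat \<Rightarrow> nat) \<Rightarrow> nat \<Rightarrow> real mat" where
  "recode_mat q p = mat (num_coeffs q p) (num_coeffs q p)
     (\<lambda>(d, c). recode q (labels q p ! d) (labels q p ! c))"

lemma model_mat_index:
  assumes "i < dim_row X" "c < num_coeffs q (dim_col X)"
  shows "model_mat q X $$ (i, c) = dummy_at X i (labels q (dim_col X) ! c)"
proof -
  have "coded_row q X i = map (dummy_at X i) (labels q (dim_col X))"
    by (simp add: coded_row_def labels_def map_concat comp_def)
  then show ?thesis
    using assms by (simp add: model_mat_def length_labels)
qed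

lemma sum_dummy_recode:
  assumes X: "categorical_data N p q X" and "i < N" "b \<in> set (labels q p)"
  shows "dummy_at X i None * recode q None b
    + (\<Sum>j<p. \<Sum>k\<in>{1..<q j}. dummy_at X i (Some (j, k)) * recode q (Some (j, k)) b)
    = contrast_at q X i b"
proof (cases b)
  case (Some jk)
  then obtain j k where b: "b = Some (j, k)" by (cases jk) auto
  let ?h = "helmert (q j) k"
  have j: "j < p"
    using assms(3) by (auto simp: b set_labels)
  have lev: "X $$ (i, j) \<in> {1..q j}"
    using X \<open>i < N\<close> j by (auto simp: categorical_data_def)
  have "(\<Sum>j'<p. \<Sum>l\<in>{1..<q j'}. dummy_at X i (Some (j', l)) * recode q (Some (j', l)) b)
      = (\<Sum>j'<p. if j' = j then \<Sum>l\<in>{1..<q j}. dummy X i j l * (?h l - ?h (q j)) else 0)"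
    by (intro sum.cong) (auto simp: b)
  also have "\<dots> = (\<Sum>l\<in>{1..<q j}. dummy X i j l * (?h l - ?h (q j)))"
    using j by simp
  also have "\<dots> = (\<Sum>l\<in>{1..<q j}. if l = X $$ (i, j) then ?h l - ?h (q j) else 0)"
    by (intro sum.cong) (auto simp: dummy_def)
  \<comment> \<open>At the baseline level no dummy variable is 1, and the right-hand side is 0 as
    well.\<close>
  also have "\<dots> = ?h (X $$ (i, j)) - ?h (q j)"
    using lev by auto
  finally show ?thesis by (simp add: b)
qed simp

lemma model_mat_recode_index:
  assumes X: "categorical_data N p q X" and "i < N" "c < num_coeffs q p"
  shows "(model_mat q X * recode_mat q p) $$ (i, c) = contrast_at q X i (labels q p ! c)"
proof -
  have dims: "dim_row X = N" "dim_col X = p"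
    using X by (auto simp: categorical_data_def)
  have "(model_mat q X * recode_mat q p) $$ (i, c)
      = (\<Sum>d<num_coeffs q p. model_mat q X $$ (i, d) * recode_mat q p $$ (d, c))"
    using assms(2,3) by (simp add: model_mat_def recode_mat_def dims scalar_prod_def atLeast0LessThan)
  also have "\<dots> = (\<Sum>d<num_coeffs q p.
      dummy_at X i (labels q p ! d) * recode q (labels q p ! d) (labels q p ! c))"
    using assms(2,3) by (intro sum.cong) (auto simp: model_mat_index dims recode_mat_def)
  also have "\<dots> = contrast_at q X i (labels q p ! c)"
    using assms by (subst sum_labels, intro sum_dummy_recode) (auto simp: length_labels)
  finally show ?thesis .
qed

text \<open>The intercept contributes 1 and predictor \<open>j\<close> contributes
  \<open>q j - 1\<close>, which is also its number of columns.\<close>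

lemma contrast_row_norm:
  assumes X: "categorical_data N p q X" and "i < N"
  shows "(\<Sum>c<num_coeffs q p. (contrast_at q X i (labels q p ! c))\<^sup>2) = real (num_coeffs q p)"
proof -
  have lev: "X $$ (i, j) \<in> {1..q j}" if "j < p" for j
    using X \<open>i < N\<close> that by (auto simp: categorical_data_def)
  have "(\<Sum>c<num_coeffs q p. (contrast_at q X i (labels q p ! c))\<^sup>2)
      = 1 + (\<Sum>j<p. \<Sum>k\<in>{1..<q j}. (helmert (q j) k (X $$ (i, j)))\<^sup>2)"
    by (subst sum_labels[where F = "\<lambda>b. (contrast_at q X i b)\<^sup>2"]) simp
  also have "(\<Sum>j<p. \<Sum>k\<in>{1..<q j}. (helmert (q j) k (X $$ (i, j)))\<^sup>2) = (\<Sum>j<p. real (q j - 1))"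
  proof (rule sum.cong[OF refl])
    fix j assume "j \<in> {..<p}"
    \<comment> \<open>An occurring level forces \<open>q j \<ge> 1\<close>, so the truncated
      subtraction is exact.\<close>
    then have "X $$ (i, j) \<in> {1..q j}" using lev[of j] by simp
    then show "(\<Sum>k\<in>{1..<q j}. (helmert (q j) k (X $$ (i, j)))\<^sup>2) = real (q j - 1)"
      using sum_helmert_over_contrasts[of "X $$ (i, j)" "q j"] by auto
  qed
  finally show ?thesis
    by (simp add: num_coeffs_def)
qed

section \<open>Balanced subsamples\<close>

text \<open>Converts sums over observations into level sums weighted by the counts that the
  criterion controls.\<close>

lemma sum_by_level:
  fixes f :: "nat \<Rightarrow> real"
  assumes X: "categorical_data n p q X" and "j < p"
  shows "(\<Sum>i<n. f (X $$ (i, j))) = (\<Sum>u=1..q j. real (level_count X j u) * f u)"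
proof -
  have "dim_row X = n"
    using X by (auto simp: categorical_data_def)
  then have "(\<Sum>u=1..q j. real (level_count X j u) * f u)
      = (\<Sum>u=1..q j. \<Sum>i<n. if X $$ (i, j) = u then f u else 0)"
    by (simp add: level_count_def sum.If_cases lessThan_def Int_def)
  also have "\<dots> = (\<Sum>i<n. \<Sum>u=1..q j. if X $$ (i, j) = u then f u else 0)"
    by (rule sum.swap)
  also have "\<dots> = (\<Sum>i<n. f (X $$ (i, j)))"
    using X \<open>j < p\<close> by (intro sum.cong) (auto simp: categorical_data_def)
  finally show ?thesis by simp
qed

lemma sum_by_level_pair:
  fixes f :: "nat \<Rightarrow> nat \<Rightarrow> real"
  assumes X: "categorical_data n p q X" and "j < p" "k < p"
  shows "(\<Sum>i<n. f (X $$ (i, j)) (X $$ (i, k)))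
    = (\<Sum>u=1..q j. \<Sum>v=1..q k. real (pair_count X j k u v) * f u v)"
proof -
  have dim: "dim_row X = n"
    using X by (auto simp: categorical_data_def)
  have "real (pair_count X j k u v) * f u v
      = (\<Sum>i<n. if X $$ (i, j) = u \<and> X $$ (i, k) = v then f u v else 0)" for u v
    by (simp add: pair_count_def dim sum.If_cases lessThan_def Int_def)
  then have "(\<Sum>u=1..q j. \<Sum>v=1..q k. real (pair_count X j k u v) * f u v)
      = (\<Sum>u=1..q j. \<Sum>i<n. \<Sum>v=1..q k. if X $$ (i, j) = u \<and> X $$ (i, k) = v then f u v else 0)"
    by (simp add: sum.swap[of _ "{..<n}"])
  also have "\<dots> = (\<Sum>i<n. \<Sum>u=1..q j. \<Sum>v=1..q k.
      if X $$ (i, j) = u \<and> X $$ (i, k) = v then f u v else 0)"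
    by (rule sum.swap)
  also have "\<dots> = (\<Sum>i<n. f (X $$ (i, j)) (X $$ (i, k)))"
  proof (rule sum.cong[OF refl])
    fix i assume "i \<in> {..<n}"
    then have lev: "X $$ (i, j) \<in> {1..q j}" "X $$ (i, k) \<in> {1..q k}"
      using X assms(2,3) by (auto simp: categorical_data_def)
    have "(\<Sum>u=1..q j. \<Sum>v=1..q k. if X $$ (i, j) = u \<and> X $$ (i, k) = v then f u v else 0)
        = (\<Sum>u=1..q j. if X $$ (i, j) = u then f u (X $$ (i, k)) else 0)"
      using lev by (intro sum.cong) auto
    then show "(\<Sum>u=1..q j. \<Sum>v=1..q k. if X $$ (i, j) = u \<and> X $$ (i, k) = v then f u v else 0)
        = f (X $$ (i, j)) (X $$ (i, k))"
      using lev by simp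
  qed
  finally show ?thesis by simp
qed

text \<open>A vanishing sum of nonnegative terms has only zero terms. The weights cancel, since a
  level in \<open>{1..q j}\<close> makes \<open>q j\<close> positive.\<close>

lemma balance_criterion_zeroD:
  assumes X: "categorical_data n p q X" and "n \<ge> 1" and bal: "balance_criterion q X = 0"
  shows "\<And>j u. j < p \<Longrightarrow> u \<in> {1..q j} \<Longrightarrow> real (level_count X j u) = real n / real (q j)"
    and "\<And>j k u v. j < p \<Longrightarrow> k < p \<Longrightarrow> j \<noteq> k \<Longrightarrow> u \<in> {1..q j} \<Longrightarrow> v \<in> {1..q k} \<Longrightarrow>
      real (pair_count X j k u v) = real n / (real (q j) * real (q k))"
proof -
  have dims: "dim_row X = n" "dim_col X = p"
    using X by (auto simp: categorical_data_def)
  define A where "A j u = (real (q j))\<^sup>2 * (1 / real (q j) - real (level_count X j u) / real n)\<^sup>2"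
    for j u
  define B where "B j k u v = real (q j) * real (q k) *
    (1 / (real (q j) * real (q k)) - real (pair_count X j k u v) / real n)\<^sup>2" for j k u v
  have A0: "A j u \<ge> 0" and B0: "B j k u v \<ge> 0" for j k u v
    by (auto simp: A_def B_def)
  have "(\<Sum>j<p. \<Sum>u=1..q j. A j u)
      + (\<Sum>j<p. \<Sum>k\<in>{..<p} - {j}. \<Sum>u=1..q j. \<Sum>v=1..q k. B j k u v) = 0"
    using bal by (simp add: balance_criterion_def dims A_def B_def)
  moreover have "(\<Sum>j<p. \<Sum>u=1..q j. A j u) \<ge> 0"
    "(\<Sum>j<p. \<Sum>k\<in>{..<p} - {j}. \<Sum>u=1..q j. \<Sum>v=1..q k. B j k u v) \<ge> 0"
    by (intro sum_nonneg A0 B0)+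
  ultimately have sums: "(\<Sum>j<p. \<Sum>u=1..q j. A j u) = 0"
    "(\<Sum>j<p. \<Sum>k\<in>{..<p} - {j}. \<Sum>u=1..q j. \<Sum>v=1..q k. B j k u v) = 0"
    by linarith+
  show "real (level_count X j u) = real n / real (q j)" if "j < p" "u \<in> {1..q j}" for j u
  proof -
    have "A j u = 0"
      using sums(1) that A0 by (auto simp: sum_nonneg_eq_0_iff sum_nonneg)
    then show ?thesis
      using that \<open>n \<ge> 1\<close> by (auto simp: A_def field_simps)
  qed
  show "real (pair_count X j k u v) = real n / (real (q j) * real (q k))"
    if "j < p" "k < p" "j \<noteq> k" "u \<in> {1..q j}" "v \<in> {1..q k}" for j k u v
  proof -
    have "B j k u v = 0"
      using sums(2) that B0 by (auto simp: sum_nonneg_eq_0_iff sum_nonneg)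
    then show ?thesis
      using that \<open>n \<ge> 1\<close> by (auto simp: B_def field_simps)
  qed
qed

text \<open>Under balance, averages over observations equal uniform averages over levels, or over
  pairs of levels. For different predictors the pair average factorises, and one factor is a zero
  contrast sum; for the same predictor the orthogonality of the contrasts applies.\<close>

lemma balanced_contrasts_orthogonal:
  assumes X: "categorical_data n p q X" and n: "n \<ge> 1" and bal: "balance_criterion q X = 0"
    and c: "c < num_coeffs q p" and d: "d < num_coeffs q p"
  shows "(\<Sum>i<n. contrast_at q X i (labels q p ! c) * contrast_at q X i (labels q p ! d))
    = (if c = d then real n else 0)"
proof -
  have single: "(\<Sum>i<n. f (X $$ (i, j))) = real n / real (q j) * (\<Sum>u=1..q j. f u)"
    if "j < p" for j and f :: "nat \<Rightarrow> real"
    using balance_criterion_zeroD(1)[OF X n bal] that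
    by (simp add: sum_by_level[OF X] sum_distrib_left)
  have mean0: "(\<Sum>i<n. helmert (q j) k (X $$ (i, j))) = 0" if "j < p" "k \<in> {1..<q j}" for j k
    using that sum_helmert[of k "q j"] by (simp add: single)
  have same: "(\<Sum>i<n. helmert (q j) k (X $$ (i, j)) * helmert (q j) l (X $$ (i, j)))
      = (if k = l then real n else 0)" if "j < p" "k \<in> {1..<q j}" "l \<in> {1..<q j}" for j k l
    using that sum_helmert_mult_helmert[OF that(2,3)]
    by (subst single[where f = "\<lambda>u. helmert (q j) k u * helmert (q j) l u"]) auto
  have diff: "(\<Sum>i<n. helmert (q j) k (X $$ (i, j)) * helmert (q j') l (X $$ (i, j'))) = 0"
    if "j < p" "j' < p" "j \<noteq> j'" "k \<in> {1..<q j}" for j j' k l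
  proof -
    have "(\<Sum>i<n. helmert (q j) k (X $$ (i, j)) * helmert (q j') l (X $$ (i, j')))
        = (\<Sum>u=1..q j. \<Sum>v=1..q j'. real n / (real (q j) * real (q j')) *
            (helmert (q j) k u * helmert (q j') l v))"
      using balance_criterion_zeroD(2)[OF X n bal] that
      by (subst sum_by_level_pair[OF X, where f = "\<lambda>u v. helmert (q j) k u * helmert (q j') l v"])
        auto
    also have "\<dots> = real n / (real (q j) * real (q j')) *
        ((\<Sum>u=1..q j. helmert (q j) k u) * (\<Sum>v=1..q j'. helmert (q j') l v))"
      unfolding sum_product unfolding sum_distrib_left by (rule refl)
    finally show ?thesis
      using that sum_helmert[of k "q j"] by simp
  qed
  have both: "(\<Sum>i<n. helmert (q j) k (X $$ (i, j)) * helmert (q j') l (X $$ (i, j')))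
      = (if (j, k) = (j', l) then real n else 0)"
    if "j < p" "j' < p" "k \<in> {1..<q j}" "l \<in> {1..<q j'}" for j j' k l
    using that same[of j k l] diff[of j j' k l] by (cases "j = j'") auto
  \<comment> \<open>Distinct labels carry the case distinction from label pairs over to column
    indices.\<close>
  have "c = d \<longleftrightarrow> labels q p ! c = labels q p ! d"
    using c d by (simp add: nth_eq_iff_index_eq distinct_labels length_labels)
  then show ?thesis
    using mean0 both
    by (cases rule: nth_labels_cases[OF c]; cases rule: nth_labels_cases[OF d]) auto
qed

section \<open>D-optimality of balanced subsamples\<close>

lemma categorical_data_subsample:
  assumes "categorical_data N p q X" "subsample X n Xs"
  shows "categorical_data n p q Xs"
proof -
  obtain s where s: "s ` {..<n} \<subseteq> {..<dim_row X}" "Xs = select_rows X n s"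
    using assms(2) by (auto simp: subsample_def)
  then have "s i < N" if "i < n" for i
    using assms(1) that by (auto simp: categorical_data_def)
  then show ?thesis
    using assms(1) s(2) by (auto simp: categorical_data_def select_rows_def)
qed

theorem theorem2:
  fixes X Xs :: "nat mat" and N p n :: nat and q :: "nat \<Rightarrow> nat"
    and W :: "'w measure" and \<beta>0 \<sigma> :: real and \<beta> :: "nat \<Rightarrow> nat \<Rightarrow> real"
    and \<epsilon> y :: "nat \<Rightarrow> 'w \<Rightarrow> real"
  assumes "categorical_data N p q X"
    and "invertible_mat (information_mat q X)"
    and "linear_model W q X \<beta>0 \<beta> \<sigma> \<epsilon> y"
    and "n \<ge> 1"
    and "subsample X n Xs"
    and "balance_criterion q Xs = 0"
  shows "D_optimal q X n Xs"
proof -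
  let ?m = "num_coeffs q p"
  let ?M = "information_mat q"
  define T where "T = recode_mat q p"
  have T: "T \<in> carrier_mat ?m ?m"
    by (simp add: T_def recode_mat_def)
  have sub: "categorical_data n p q Y" if "subsample X n Y" for Y
    using categorical_data_subsample assms(1) that by blast
  have Z: "model_mat q Y \<in> carrier_mat n ?m" if "subsample X n Y" for Y
    using sub[OF that] by (auto simp: categorical_data_def model_mat_def)
  have M: "?M Y \<in> carrier_mat ?m ?m" if "subsample X n Y" for Y
    using Z[OF that] by (simp add: information_mat_def)
  have ZT: "model_mat q Y * T \<in> carrier_mat n ?m" if "subsample X n Y" for Y
    using Z[OF that] T by simp
  have nonneg: "0 \<le> det (?M Y)" if "subsample X n Y" for Y
    using gram_det_bounds[OF Z[OF that]] by (simp add: information_mat_def)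
  have le: "(det T)\<^sup>2 * det (?M Y) \<le> real n ^ ?m" if Y: "subsample X n Y" for Y
  proof -
    have "(\<Sum>c<?m. ((model_mat q Y * T) $$ (i, c))\<^sup>2) = real ?m" if "i < n" for i
      by (rule trans[OF sum.cong contrast_row_norm[OF sub[OF Y] that]])
        (simp_all only: T_def lessThan_iff model_mat_recode_index[OF sub[OF Y] that])
    then show ?thesis
      using det_gram_le_power[OF ZT[OF Y]] assms(4)
      by (simp add: det_gram_mult[OF Z[OF Y] T] information_mat_def)
  qed
  have eq: "(det T)\<^sup>2 * det (?M Xs) = real n ^ ?m"
  proof -
    let ?V = "model_mat q Xs * T"
    have "transpose_mat ?V * ?V = real n \<cdot>\<^sub>m 1\<^sub>m ?m"
    proof (rule eq_matI)
      fix c d assume "c < dim_row (real n \<cdot>\<^sub>m 1\<^sub>m ?m)" "d < dim_col (real n \<cdot>\<^sub>m 1\<^sub>m ?m)"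
      then have cd: "c < ?m" "d < ?m" by auto
      have "(transpose_mat ?V * ?V) $$ (c, d)
          = (\<Sum>i<n. contrast_at q Xs i (labels q p ! c) * contrast_at q Xs i (labels q p ! d))"
        by (rule trans[OF gram_index[OF ZT[OF assms(5)] cd] sum.cong])
          (simp_all only: T_def lessThan_iff model_mat_recode_index[OF sub[OF assms(5)]] cd)
      also have "\<dots> = (if c = d then real n else 0)"
        using balanced_contrasts_orthogonal[OF sub[OF assms(5)] assms(4,6) cd] .
      finally show "(transpose_mat ?V * ?V) $$ (c, d) = (real n \<cdot>\<^sub>m 1\<^sub>m ?m) $$ (c, d)"
        using cd by simp
    qed (use ZT[OF assms(5)] in auto)
    then show ?thesis
      using det_gram_mult[OF Z[OF assms(5)] T] by (simp add: information_mat_def)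
  qed
  \<comment> \<open>The right-hand side of \<open>eq\<close> is positive, so both factors are
    nonzero: nonsingularity of \<open>T\<close> is read off from the balanced subsample rather than
    computed.\<close>
  have T0: "(det T)\<^sup>2 > 0" and s0: "det (?M Xs) \<noteq> 0"
    using eq assms(4) by (auto intro: ccontr)
  have "det (the (mat_inverse (?M Xs))) \<le> det (the (mat_inverse (?M Xt)))"
    if Xt: "subsample X n Xt" and inv: "invertible_mat (?M Xt)" for Xt
  proof -
    have t0: "det (?M Xt) \<noteq> 0"
      using inv invertible_mat_iff_det[OF M[OF Xt]] by blast
    moreover have "det (?M Xt) \<le> det (?M Xs)"
      using le[OF Xt] T0 unfolding eq[symmetric] by simp
    \<comment> \<open>Nonnegativity and \<open>t0\<close> make the determinant for \<open>Xt\<close>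
      positive, so passing to reciprocals reverses the inequality.\<close>
    ultimately show ?thesis
      using nonneg[OF Xt] s0
      by (simp add: det_mat_inverse[OF M[OF Xt]] det_mat_inverse[OF M[OF assms(5)]] frac_le)
  qed
  then show ?thesis
    using assms(5) s0 invertible_mat_iff_det[OF M[OF assms(5)]] by (auto simp: D_optimal_def)
qed

end
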